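(* Let $\mathbf{P}=(P,\preceq_+,\preceq_-)$ be a double poset. Then $(g,t)\in\mathbb{R}^P\times\mathbb{R}$ lies in $\overline{\mathcal{C}}(\mathbf{P})$ if and only if \[\sum_{a\in C_+}g(a)-t\le1\quad\text{and}\quad\sum_{a\in C_-}-g(a)+t\le1\] for all chains $C_+$ of $(P,\preceq_+)$ and all chains $C_-$ of $(P,\preceq_-)$.
   Context: A double poset is a finite set $P$ with two partial orders $\preceq_+,\preceq_-$ (no compatibility assumed). For a poset $Q$, the chain polytope is $\mathcal{C}(Q)=\{g:Q\to\mathbb{R}_{\ge0}: \sum_{a\in C}g(a)\le1\text{ for all chains }C\subseteq Q\}$. The double chain polytope is $\overline{\mathcal{C}}(\mathbf{P})=\operatorname{conv}\big((2\mathcal{C}(P,\preceq_+)\times\{1\})\cup(-2\mathcal{C}(P,\preceq_-)\times\{-1\})\big)\subset\mathbb{R}^P\times\mathbb{R}$. Chains are totally ordered subsets, including the empty one. *)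

theory Defs
  imports "HOL-Analysis.Analysis" "HOL-Analysis.Finite_Function_Topology"
begin

definition double_poset :: "'a set \<Rightarrow> 'a rel \<Rightarrow> 'a rel \<Rightarrow> bool" where
  "double_poset P rp rm \<longleftrightarrow> finite P \<and> partial_order_on P rp \<and> partial_order_on P rm"

text \<open>
  For a finite set \<open>P\<close> of an arbitrary type, the space of real functions on \<open>P\<close> is represented
  by the finitely supported functions that vanish outside \<open>P\<close>. They form a subspace of the
  real vector space \<open>'a \<Rightarrow>\<^sub>0 real\<close>; the empty set \<open>P\<close> is included.
\<close>

definition functions_on :: "'a set \<Rightarrow> ('a \<Rightarrow>\<^sub>0 real) set" where
  "functions_on P = {g. Poly_Mapping.keys g \<subseteq> P}"

text \<open>
  If \<open>r\<close> is a (reflexive) partial order on \<open>Q\<close>, contained in \<open>Q \<times> Q\<close>, then \<open>Chains r\<close> consists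
  of the totally ordered subsets of \<open>Q\<close>, including the empty one.
\<close>

definition chain_polytope :: "'a set \<Rightarrow> 'a rel \<Rightarrow> ('a \<Rightarrow>\<^sub>0 real) set" where
  "chain_polytope Q r =
    {g \<in> functions_on Q.
      (\<forall>a\<in>Q. 0 \<le> Poly_Mapping.lookup g a) \<and>
      (\<forall>C\<in>Chains r. (\<Sum>a\<in>C. Poly_Mapping.lookup g a) \<le> 1)}"

definition double_chain_polytope ::
    "'a set \<Rightarrow> 'a rel \<Rightarrow> 'a rel \<Rightarrow> (('a \<Rightarrow>\<^sub>0 real) \<times> real) set" where
  "double_chain_polytope P rp rm =
    convex hull
      ((\<lambda>g. 2 *\<^sub>R g) ` chain_polytope P rp \<times> {1} \<union>
       (\<lambda>g. (- 2) *\<^sub>R g) ` chain_polytope P rm \<times> {- 1})"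

end

theory Submission
  imports Defs
begin

text \<open>
  A convex combination of the two pieces at height \<open>t\<close> has the form
  \<open>(1 + t) u - (1 - t) v\<close> with \<open>u\<close>, \<open>v\<close> in the two chain polytopes. Conversely, if the
  inequalities hold, then \<open>u\<close> and \<open>v\<close> may be taken to be the rescaled positive and negative parts
  of \<open>g\<close>: the sum of the positive part over a chain equals the sum of \<open>g\<close> over the
  subchain on which \<open>g\<close> is positive.
\<close>

lemma lookup_scaleR:
  fixes x :: "'a \<Rightarrow>\<^sub>0 real"
  shows "Poly_Mapping.lookup (c *\<^sub>R x) a = c * Poly_Mapping.lookup x a"
proof -
  have "finite {a. c * Poly_Mapping.lookup x a \<noteq> 0}"
    by (rule finite_subset[OF _ finite_keys[of x]]) (auto simp: in_keys_iff)
  then show ?thesis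
    by (simp add: scaleR_poly_mapping_def)
qed

lemma Chains_subset: "C \<in> Chains r \<Longrightarrow> D \<subseteq> C \<Longrightarrow> D \<in> Chains r"
  by (auto simp: Chains_def)

lemma Chains_subset_carrier: "partial_order_on P r \<Longrightarrow> C \<in> Chains r \<Longrightarrow> C \<subseteq> P"
  by (auto simp: Chains_def partial_order_on_def preorder_on_def)

text \<open>Both sides of each inequality are affine in \<open>p\<close>, so the set is an
  intersection of half-spaces. The factor \<open>c\<close> lets one lemma serve both families:
  \<open>c = 1\<close> for the chains of \<open>rp\<close>, \<open>c = - 1\<close> for those of
  \<open>rm\<close>.\<close>

lemma convex_chain_inequalities:
  "convex {p :: ('a \<Rightarrow>\<^sub>0 real) \<times> real.
    \<forall>C\<in>A. (\<Sum>a\<in>C. c * Poly_Mapping.lookup (fst p) a) \<le> 1 + c * snd p}"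
    (is "convex ?S")
proof (rule convexI)
  fix p q :: "('a \<Rightarrow>\<^sub>0 real) \<times> real" and u v :: real
  assume p: "p \<in> ?S" and q: "q \<in> ?S" and uv: "0 \<le> u" "0 \<le> v" "u + v = 1"
  have "(\<Sum>a\<in>C. c * Poly_Mapping.lookup (fst (u *\<^sub>R p + v *\<^sub>R q)) a)
      \<le> 1 + c * snd (u *\<^sub>R p + v *\<^sub>R q)" if C: "C \<in> A" for C
  proof -
    have "(\<Sum>a\<in>C. c * Poly_Mapping.lookup (fst (u *\<^sub>R p + v *\<^sub>R q)) a) =
        u * (\<Sum>a\<in>C. c * Poly_Mapping.lookup (fst p) a) +
        v * (\<Sum>a\<in>C. c * Poly_Mapping.lookup (fst q) a)"
      by (simp add: lookup_add lookup_scaleR sum.distrib sum_distrib_left algebra_simps)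
    also have "\<dots> \<le> u * (1 + c * snd p) + v * (1 + c * snd q)"
      using p q C uv by (intro add_mono mult_left_mono) auto
    also have "\<dots> = (u + v) + c * snd (u *\<^sub>R p + v *\<^sub>R q)"
      by (simp add: algebra_simps)
    finally show ?thesis
      using uv by simp
  qed
  then show "u *\<^sub>R p + v *\<^sub>R q \<in> ?S"
    by blast
qed

text \<open>Applied to \<open>g\<close> with \<open>s = 1 + t\<close> and to \<open>- g\<close> with
  \<open>s = 1 - t\<close>. The product form \<open>s * u\<close> of the conclusion avoids division
  and so covers the endpoints \<open>t = - 1\<close> and \<open>t = 1\<close>, where one of the two
  scales is zero.\<close>

lemma scaled_positive_part_in_chain_polytope:
  fixes h :: "'a \<Rightarrow>\<^sub>0 real"
  assumes "finite P" "partial_order_on P r" "h \<in> functions_on P" "0 \<le> s"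
    and le: "\<And>C. C \<in> Chains r \<Longrightarrow> (\<Sum>a\<in>C. Poly_Mapping.lookup h a) \<le> s"
  obtains u where "u \<in> chain_polytope P r"
    and "\<And>a. s * Poly_Mapping.lookup u a = max 0 (Poly_Mapping.lookup h a)"
proof
  \<comment> \<open>for \<open>s = 0\<close> the division by zero makes this function zero\<close>
  define u where "u = Poly_Mapping.map (\<lambda>x. max 0 x / s) h"
  have u: "Poly_Mapping.lookup u a = max 0 (Poly_Mapping.lookup h a) / s" for a
    by (simp add: u_def map.rep_eq when_def)
  show "s * Poly_Mapping.lookup u a = max 0 (Poly_Mapping.lookup h a)" for a
  proof (cases "s = 0")
    case True
    \<comment> \<open>With \<open>s = 0\<close>, singleton chains bound \<open>h\<close> by 0 at
      each point of \<open>P\<close>, and \<open>h\<close> vanishes elsewhere. Its positive part is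
      therefore zero, as the left-hand side is.\<close>
    have "Poly_Mapping.lookup h a \<le> 0"
    proof (cases "a \<in> P")
      case True
      then have "{a} \<in> Chains r"
        using assms(2) by (auto simp: Chains_def partial_order_on_def preorder_on_def refl_on_def)
      then show ?thesis
        using le[of "{a}"] \<open>s = 0\<close> by simp
    next
      case False
      then show ?thesis
        using assms(3) in_keys_iff[of a h] by (auto simp: functions_on_def)
    qed
    then show ?thesis
      using True by simp
  qed (simp add: u)
  have "(\<Sum>a\<in>C. Poly_Mapping.lookup u a) \<le> 1" if C: "C \<in> Chains r" for C
  proof -
    have fin: "finite C"
      using Chains_subset_carrier[OF assms(2) C] assms(1) finite_subset by blast
    have "(\<Sum>a\<in>C. max 0 (Poly_Mapping.lookup h a)) =
        (\<Sum>a\<in>{a \<in> C. 0 < Poly_Mapping.lookup h a}. Poly_Mapping.lookup h a)"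
      using fin by (intro sum.mono_neutral_cong_right) auto
    also have "\<dots> \<le> s"
      by (intro le Chains_subset[OF C]) auto
    finally show ?thesis
      using assms(4) by (auto simp: u divide_le_eq_1 simp flip: sum_divide_distrib)
  qed
  moreover have "u \<in> functions_on P"
    using assms(3) by (auto simp: functions_on_def in_keys_iff u subset_iff)
  ultimately show "u \<in> chain_polytope P r"
    using assms(4) by (simp add: chain_polytope_def u)
qed

theorem theorem3p7:
  fixes P :: "'a set" and rp rm :: "'a rel"
    and g :: "'a \<Rightarrow>\<^sub>0 real" and t :: real
  assumes "double_poset P rp rm"
    and "g \<in> functions_on P"
  shows "(g, t) \<in> double_chain_polytope P rp rm \<longleftrightarrow>
    (\<forall>Cp\<in>Chains rp. \<forall>Cm\<in>Chains rm.
      (\<Sum>a\<in>Cp. Poly_Mapping.lookup g a) - t \<le> 1 \<and>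
      (\<Sum>a\<in>Cm. - Poly_Mapping.lookup g a) + t \<le> 1)"
proof
  define H where "H r c =
    {p :: ('a \<Rightarrow>\<^sub>0 real) \<times> real.
      \<forall>C\<in>Chains r. (\<Sum>a\<in>C. c * Poly_Mapping.lookup (fst p) a) \<le> 1 + c * snd p}"
    for r c
  have "double_chain_polytope P rp rm \<subseteq> H rp 1 \<inter> H rm (- 1)"
    unfolding double_chain_polytope_def
  proof (rule hull_minimal)
    \<comment> \<open>The orders \<open>r\<close> and \<open>r'\<close> are independent because each
      generator must also satisfy the inequalities of the other order. At
      \<open>(2 *\<^sub>R x, 1)\<close> the inequality for a chain of \<open>rm\<close> reduces to
      nonnegativity of the sum of \<open>x\<close> over that chain; the other piece is
      symmetric.\<close>
    have bounds: "0 \<le> (\<Sum>a\<in>C. Poly_Mapping.lookup x a)"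
      if "x \<in> chain_polytope P r" "C \<in> Chains r'" "partial_order_on P r'" for x r r' C
      using that Chains_subset_carrier[OF that(3,2)]
      by (intro sum_nonneg) (auto simp: chain_polytope_def)
    have po: "partial_order_on P rp" "partial_order_on P rm"
      using assms(1) by (auto simp: double_poset_def)
    show "(\<lambda>g. 2 *\<^sub>R g) ` chain_polytope P rp \<times> {1} \<union>
        (\<lambda>g. (- 2) *\<^sub>R g) ` chain_polytope P rm \<times> {- 1} \<subseteq> H rp 1 \<inter> H rm (- 1)"
      using bounds[OF _ _ po(1)] bounds[OF _ _ po(2)]
      by (auto simp: H_def sum_negf lookup_scaleR chain_polytope_def simp flip: sum_distrib_left)
    show "convex (H rp 1 \<inter> H rm (- 1))"
      unfolding H_def by (intro convex_Int convex_chain_inequalities)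
  qed
  then show "\<forall>Cp\<in>Chains rp. \<forall>Cm\<in>Chains rm.
      (\<Sum>a\<in>Cp. Poly_Mapping.lookup g a) - t \<le> 1 \<and>
      (\<Sum>a\<in>Cm. - Poly_Mapping.lookup g a) + t \<le> 1"
    if "(g, t) \<in> double_chain_polytope P rp rm"
    using that by (fastforce simp: H_def)
next
  assume ineqs: "\<forall>Cp\<in>Chains rp. \<forall>Cm\<in>Chains rm.
      (\<Sum>a\<in>Cp. Poly_Mapping.lookup g a) - t \<le> 1 \<and>
      (\<Sum>a\<in>Cm. - Poly_Mapping.lookup g a) + t \<le> 1"
  have empty: "{} \<in> Chains r" for r :: "'a rel"
    by (simp add: Chains_def)
  have plus: "(\<Sum>a\<in>C. Poly_Mapping.lookup g a) \<le> 1 + t" if "C \<in> Chains rp" for C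
    using ineqs that empty by force
  have minus: "(\<Sum>a\<in>C. Poly_Mapping.lookup (- g) a) \<le> 1 - t" if "C \<in> Chains rm" for C
    using ineqs that empty by force
  have t: "0 \<le> 1 + t" "0 \<le> 1 - t"
    using plus[OF empty] minus[OF empty] by simp_all
  have P: "finite P" "partial_order_on P rp" "partial_order_on P rm" "- g \<in> functions_on P"
    using assms by (auto simp: double_poset_def functions_on_def)
  obtain u where u: "u \<in> chain_polytope P rp"
    "\<And>a. (1 + t) * Poly_Mapping.lookup u a = max 0 (Poly_Mapping.lookup g a)"
    using scaled_positive_part_in_chain_polytope[OF P(1,2) assms(2) t(1) plus] by blast
  obtain v where v: "v \<in> chain_polytope P rm"
    "\<And>a. (1 - t) * Poly_Mapping.lookup v a = max 0 (Poly_Mapping.lookup (- g) a)"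
    using scaled_positive_part_in_chain_polytope[OF P(1,3,4) t(2) minus] by blast
  \<comment> \<open>The weights are forced by the last coordinate: they sum to 1 and average the
    heights 1 and -1 to \<open>t\<close>. The factors 2 cancel the halves, leaving the positive part
    of \<open>g\<close> minus that of \<open>- g\<close>.\<close>
  have g: "g = ((1 + t) / 2) *\<^sub>R 2 *\<^sub>R u + ((1 - t) / 2) *\<^sub>R (- 2) *\<^sub>R v"
  proof (rule poly_mapping_eqI)
    fix a
    show "Poly_Mapping.lookup g a =
        Poly_Mapping.lookup (((1 + t) / 2) *\<^sub>R 2 *\<^sub>R u + ((1 - t) / 2) *\<^sub>R (- 2) *\<^sub>R v) a"
      unfolding lookup_add lookup_scaleR using u(2)[of a] v(2)[of a] by simp
  qed
  have "((1 + t) / 2) *\<^sub>R (2 *\<^sub>R u, 1) + ((1 - t) / 2) *\<^sub>R ((- 2) *\<^sub>R v, - 1)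
      \<in> double_chain_polytope P rp rm"
    unfolding double_chain_polytope_def using t u(1) v(1)
    by (intro convexD[OF convex_convex_hull] hull_inc) (auto simp: field_simps)
  also have "((1 + t) / 2) *\<^sub>R (2 *\<^sub>R u, 1) + ((1 - t) / 2) *\<^sub>R ((- 2) *\<^sub>R v, - 1) = (g, t)"
    unfolding g by (simp add: field_simps)
  finally show "(g, t) \<in> double_chain_polytope P rp rm" .
qed

end
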